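(* Suppose that: (i) all second partial derivatives of $J:\mathbb{R}^n\times\mathbb{R}^d\to\mathbb{R}$ exist and are Lipschitz continuous, and there are scalars $0<m\le L$ such that for every $\theta\in\Theta$ and all $\xi,\xi'\in\mathbb{R}^n$ $$J(\xi,\theta)+\nabla_\xi J(\xi,\theta)^\top(\xi'-\xi)+\tfrac{m}{2}\|\xi'-\xi\|_2^2\le J(\xi',\theta)\le J(\xi,\theta)+\nabla_\xi J(\xi,\theta)^\top(\xi'-\xi)+\tfrac{L}{2}\|\xi'-\xi\|_2^2;$$ (ii) $S_{\mathcal C}\subseteq\mathbb{R}^n$ is convex and closed; (iii) $\Theta\subset\mathbb{R}^d$ is convex and compact; (iv) $S_\xi^0\subseteq S_{\mathcal C}$ is bounded. Let $c_\alpha,C_\alpha\in(0,\tfrac2L)$ with $c_\alpha\le C_\alpha$, and let $\gamma:=\max_{\alpha\in[c_\alpha,C_\alpha]}\max\{|1-\alpha m|,|1-\alpha L|\}$. For $\xi_0\in S_\xi^0$ and $k\ge 0$ define $$\beta_k(\xi_0):=\gamma^k\cdot\max_{\theta\in\Theta}\|\xi^\star(\theta)-\xi_0\|_2 .$$ Then for every $\xi_0\in S_\xi^0$, every $k\ge0$ and every $\alpha_{0:k-1}\in[c_\alpha,C_\alpha]^k$, $$\mathrm{dist}\big(S_\xi^\star,\;S_{\xi,k}(\xi_0,\alpha_{0:k-1})\big)\le\beta_k(\xi_0).$$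
   Context: For $\theta\in\Theta$, $\xi^\star(\theta)$ denotes the unique minimizer of $J(\cdot,\theta)$ over $S_{\mathcal C}$, and $S_\xi^\star:=\{\xi^\star(\theta):\theta\in\Theta\}$ is the minimizer set. $\mathrm{proj}_{S_{\mathcal C}}$ denotes Euclidean projection onto $S_{\mathcal C}$. The projected gradient descent (PGD) map is $f_{\mathrm{PGD}}(\xi,\theta,\alpha):=\mathrm{proj}_{S_{\mathcal C}}(\xi-\alpha\nabla_\xi J(\xi,\theta))$. For $\alpha_{0:k-1}=(\alpha_0,\dots,\alpha_{k-1})\in\mathbb{R}^k$, $\phi_k(\xi_0,\theta,\alpha_{0:k-1})$ is the $k$-th PGD iterate, obtained from $\xi_{j+1}=f_{\mathrm{PGD}}(\xi_j,\theta,\alpha_j)$, $j=0,\dots,k-1$, starting at $\xi_0$ (so $\phi_0=\xi_0$). The forward reachable set at iteration $k$ is $S_{\xi,k}(\xi_0,\alpha_{0:k-1}):=\{\phi_k(\xi_0,\theta,\alpha_{0:k-1}):\theta\in\Theta\}$. For sets $S,S'\subseteq\mathbb{R}^n$, $\mathrm{dist}(S,S'):=\inf\{\epsilon>0:\ S\subseteq S'\oplus\epsilon\mathbb{B}_2^n,\ S'\subseteq S\oplus\epsilon\mathbb{B}_2^n\}$ is the Hausdorff distance, where $\oplus$ is the Minkowski sum and $\mathbb{B}_2^n$ is the unit Euclidean ball. *)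

theory Defs
  imports "HOL-Analysis.Analysis"
begin

definition partial_differentiable :: "'a::euclidean_space \<Rightarrow> ('a \<Rightarrow> real) \<Rightarrow> 'a \<Rightarrow> bool"
  where "partial_differentiable b f x \<longleftrightarrow> (\<lambda>t::real. f (x + t *\<^sub>R b)) field_differentiable (at 0)"

definition partial_deriv :: "'a::euclidean_space \<Rightarrow> ('a \<Rightarrow> real) \<Rightarrow> 'a \<Rightarrow> real"
  where "partial_deriv b f x = deriv (\<lambda>t::real. f (x + t *\<^sub>R b)) 0"

text \<open>On \<open>(real ^ 'n) \<times> (real ^ 'd)\<close> the set \<open>Basis\<close> consists of the coordinate directions of
  both factors, so mixed partial derivatives across the factors are included below. The Lipschitz
  condition is global.\<close>

definition second_partials_Lipschitz :: "('a::euclidean_space \<Rightarrow> real) \<Rightarrow> bool"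
  where "second_partials_Lipschitz f \<longleftrightarrow>
    (\<forall>b\<in>Basis. \<forall>x. partial_differentiable b f x) \<and>
    (\<forall>b\<in>Basis. \<forall>b'\<in>Basis.
       (\<forall>x. partial_differentiable b' (partial_deriv b f) x) \<and>
       (\<exists>K. K-lipschitz_on UNIV (partial_deriv b' (partial_deriv b f))))"

definition grad :: "('a::real_inner \<Rightarrow> real) \<Rightarrow> 'a \<Rightarrow> 'a"
  where "grad f x = (THE D. GDERIV f x :> D)"

definition minimizer :: "('a \<times> 'b \<Rightarrow> real) \<Rightarrow> 'a set \<Rightarrow> 'b \<Rightarrow> 'a"
  where "minimizer J S \<theta> = (THE \<xi>. is_arg_min (\<lambda>\<xi>. J (\<xi>, \<theta>)) (\<lambda>\<xi>. \<xi> \<in> S) \<xi>)"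

definition minimizer_set :: "('a \<times> 'b \<Rightarrow> real) \<Rightarrow> 'a set \<Rightarrow> 'b set \<Rightarrow> 'a set"
  where "minimizer_set J S \<Theta> = minimizer J S ` \<Theta>"

definition f_PGD ::
    "('a::euclidean_space \<times> 'b \<Rightarrow> real) \<Rightarrow> 'a set \<Rightarrow> 'a \<Rightarrow> 'b \<Rightarrow> real \<Rightarrow> 'a"
  where "f_PGD J S \<xi> \<theta> \<alpha> = closest_point S (\<xi> - \<alpha> *\<^sub>R grad (\<lambda>\<xi>. J (\<xi>, \<theta>)) \<xi>)"

text \<open>A step size tuple of length \<open>k\<close> is represented by a sequence \<open>\<alpha>\<close>, of which the \<open>k\<close>-th iterate
  uses only the entries \<open>\<alpha> j\<close> with \<open>j < k\<close>.\<close>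

primrec pgd_iterate ::
    "('a::euclidean_space \<times> 'b \<Rightarrow> real) \<Rightarrow> 'a set \<Rightarrow> nat \<Rightarrow> 'a \<Rightarrow> 'b \<Rightarrow> (nat \<Rightarrow> real) \<Rightarrow> 'a"
  where
    "pgd_iterate J S 0 \<xi>0 \<theta> \<alpha> = \<xi>0"
  | "pgd_iterate J S (Suc k) \<xi>0 \<theta> \<alpha> = f_PGD J S (pgd_iterate J S k \<xi>0 \<theta> \<alpha>) \<theta> (\<alpha> k)"

definition reachable_set ::
    "('a::euclidean_space \<times> 'b \<Rightarrow> real) \<Rightarrow> 'a set \<Rightarrow> 'b set \<Rightarrow> nat \<Rightarrow> 'a \<Rightarrow> (nat \<Rightarrow> real) \<Rightarrow> 'a set"
  where "reachable_set J S \<Theta> k \<xi>0 \<alpha> = (\<lambda>\<theta>. pgd_iterate J S k \<xi>0 \<theta> \<alpha>) ` \<Theta>"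

text \<open>Set addition is the Minkowski sum of \<^theory>\<open>HOL-Library.Set_Algebras\<close>. The infimum is
  taken in the extended reals, so that the infimum over the empty set is \<open>\<infinity>\<close>.\<close>

definition Hausdorff_dist :: "'a::real_normed_vector set \<Rightarrow> 'a set \<Rightarrow> ereal"
  where "Hausdorff_dist S S' =
    (INF \<epsilon>\<in>{\<epsilon>::real. \<epsilon> > 0 \<and> S \<subseteq> S' + (*\<^sub>R) \<epsilon> ` cball 0 1 \<and> S' \<subseteq> S + (*\<^sub>R) \<epsilon> ` cball 0 1}. ereal \<epsilon>)"

text \<open>\<open>GREATEST\<close> denotes an attained maximum, not a supremum.\<close>

definition contraction_rate :: "real \<Rightarrow> real \<Rightarrow> real \<Rightarrow> real \<Rightarrow> real"
  where "contraction_rate m L c C =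
    (GREATEST r. r \<in> (\<lambda>\<alpha>. max \<bar>1 - \<alpha> * m\<bar> \<bar>1 - \<alpha> * L\<bar>) ` {c..C})"

definition error_bound ::
    "('a::real_normed_vector \<times> 'b \<Rightarrow> real) \<Rightarrow> 'a set \<Rightarrow> 'b set \<Rightarrow> real \<Rightarrow> nat \<Rightarrow> 'a \<Rightarrow> real"
  where "error_bound J S \<Theta> \<gamma> k \<xi>0 =
    \<gamma> ^ k * (GREATEST r. r \<in> (\<lambda>\<theta>. norm (minimizer J S \<theta> - \<xi>0)) ` \<Theta>)"

end

theory Submission
  imports Defs
begin

text \<open>The two quadratic bounds say that the gradient of \<open>J(\<cdot>, \<theta>) - m/2 \<parallel>\<cdot>\<parallel>\<^sup>2\<close> is cocoercive with constant
  \<open>1/(L - m)\<close>. Hence \<open>\<nabla>J(x) - \<nabla>J(y)\<close> lies in the ball of centre \<open>(m + L)/2 (x - y)\<close> and radius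
  \<open>(L - m)/2 \<parallel>x - y\<parallel>\<close>, which makes a gradient step, and so a PGD step, a contraction with factor
  \<open>max \<bar>1 - \<alpha>m\<bar> \<bar>1 - \<alpha>L\<bar>\<close>. Its Banach fixed point satisfies the variational inequality
  \<open>\<nabla>J(z) \<bullet> (y - z) \<ge> 0\<close> on \<open>S_C\<close>; this does not involve \<open>\<alpha>\<close>, identifies \<open>z\<close> as the unique minimizer
  and shows that \<open>z\<close> is fixed by the PGD step for every step size. The maximum in \<open>\<beta>_k\<close> is attained
  because \<open>\<theta> \<mapsto> \<xi>*(\<theta>)\<close> is continuous: strong monotonicity reduces this to continuity of the gradient
  in \<open>\<theta>\<close>, which holds since the first partial derivatives themselves have continuous partials.\<close>

section \<open>Continuity from continuous partial derivatives\<close>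

text \<open>On the unit ball around \<open>x\<close> all partials share a bound \<open>B\<close>, by
  compactness. Walking from \<open>x\<close> to \<open>x + h\<close> one coordinate at a time, with
  the mean value inequality on each leg, bounds the increment of \<open>f\<close> by
  \<open>B\<close> times the sum of the \<open>\<bar>h \<bullet> b\<bar>\<close>.\<close>

lemma continuous_if_continuous_partials:
  fixes f :: "'a::euclidean_space \<Rightarrow> real"
  assumes diff: "\<And>b x. b \<in> Basis \<Longrightarrow> partial_differentiable b f x"
    and cont: "\<And>b. b \<in> Basis \<Longrightarrow> continuous_on UNIV (partial_deriv b f)"
  shows "continuous_on UNIV f"
proof -
  have deriv: "((\<lambda>t. f (x + t *\<^sub>R b)) has_field_derivative partial_deriv b f (x + t *\<^sub>R b)) (at t)"
    if b: "b \<in> Basis" for x b t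
  proof -
    have "((\<lambda>s. f ((x + t *\<^sub>R b) + s *\<^sub>R b)) has_field_derivative partial_deriv b f (x + t *\<^sub>R b)) (at 0)"
      using diff[OF b, of "x + t *\<^sub>R b"] DERIV_deriv_iff_field_differentiable
      unfolding partial_differentiable_def partial_deriv_def by blast
    then have "((\<lambda>s. f (x + (s + t) *\<^sub>R b)) has_field_derivative partial_deriv b f (x + t *\<^sub>R b)) (at 0)"
      by (simp add: algebra_simps)
    then show ?thesis
      using DERIV_shift[of "\<lambda>t. f (x + t *\<^sub>R b)" _ 0 t] by simp
  qed
  have "isCont f x" for x
  proof -
    have "compact (\<Union>b\<in>Basis. partial_deriv b f ` cball x 1)"
      by (intro compact_UN finite_Basis compact_continuous_image compact_cball
          continuous_on_subset[OF cont]) auto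
    then obtain B where "\<forall>r\<in>(\<Union>b\<in>Basis. partial_deriv b f ` cball x 1). \<bar>r\<bar> \<le> B"
      using compact_imp_bounded bounded_real by blast
    then have B: "\<bar>partial_deriv b f y\<bar> \<le> B" if "b \<in> Basis" "y \<in> cball x 1" for b y
      using that by blast
    have step: "\<bar>f (x + (\<Sum>b\<in>A. (h \<bullet> b) *\<^sub>R b)) - f x\<bar> \<le> B * (\<Sum>b\<in>A. \<bar>h \<bullet> b\<bar>)"
      if "finite A" "A \<subseteq> Basis" "norm h \<le> 1" for h A
      using that(1,2)
    proof (induction A)
      case empty
      then show ?case by simp
    next
      case (insert a A)
      define y where "y = x + (\<Sum>b\<in>A. (h \<bullet> b) *\<^sub>R b)"
      have a: "a \<in> Basis" using insert by simp
      \<comment> \<open>\<open>B\<close> is valid only on \<open>cball x 1\<close>, so the leg in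
        direction \<open>a\<close> must stay there: each coordinate of the displacement from
        \<open>x\<close> is dominated by that of \<open>h\<close>, and
        \<open>norm h \<le> 1\<close>.\<close>
      have seg: "y + t *\<^sub>R a \<in> cball x 1" if "t \<in> closed_segment 0 (h \<bullet> a)" for t
      proof -
        have t: "\<bar>t\<bar> \<le> \<bar>h \<bullet> a\<bar>"
          using that by (auto simp: closed_segment_eq_real_ivl split: if_splits)
        have "norm ((\<Sum>b\<in>A. (h \<bullet> b) *\<^sub>R b) + t *\<^sub>R a) \<le> norm h"
        proof (rule norm_le_componentwise)
          fix i :: 'a assume i: "i \<in> Basis"
          have "(\<Sum>b\<in>A. (h \<bullet> b) *\<^sub>R b) \<bullet> i = (\<Sum>b\<in>A. if b = i then h \<bullet> i else 0)"
            unfolding inner_sum_left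
            by (rule sum.cong) (use insert i in \<open>auto simp: inner_Basis subset_iff\<close>)
          also have "\<dots> = (if i \<in> A then h \<bullet> i else 0)"
            using insert by simp
          finally show "\<bar>((\<Sum>b\<in>A. (h \<bullet> b) *\<^sub>R b) + t *\<^sub>R a) \<bullet> i\<bar> \<le> \<bar>h \<bullet> i\<bar>"
            using t a i insert by (auto simp: inner_add_left inner_Basis)
        qed
        moreover have "dist x (y + t *\<^sub>R a) = norm ((\<Sum>b\<in>A. (h \<bullet> b) *\<^sub>R b) + t *\<^sub>R a)"
          by (subst dist_commute) (simp add: y_def dist_norm)
        ultimately show ?thesis
          using \<open>norm h \<le> 1\<close> by simp
      qed
      have "norm (f (y + (h \<bullet> a) *\<^sub>R a) - f (y + 0 *\<^sub>R a)) \<le> B * norm (h \<bullet> a - 0)"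
        by (rule field_differentiable_bound[where S = "closed_segment 0 (h \<bullet> a)"
              and f' = "\<lambda>t. partial_deriv a f (y + t *\<^sub>R a)"])
          (use seg B a in \<open>auto intro: DERIV_subset[OF deriv]\<close>)
      then have "\<bar>f (y + (h \<bullet> a) *\<^sub>R a) - f y\<bar> \<le> B * \<bar>h \<bullet> a\<bar>" by simp
      moreover have "\<bar>f y - f x\<bar> \<le> B * (\<Sum>b\<in>A. \<bar>h \<bullet> b\<bar>)"
        using insert by (simp add: y_def)
      moreover have "x + (\<Sum>b\<in>insert a A. (h \<bullet> b) *\<^sub>R b) = y + (h \<bullet> a) *\<^sub>R a"
        using insert by (simp add: y_def algebra_simps)
      moreover have "B * (\<Sum>b\<in>insert a A. \<bar>h \<bullet> b\<bar>) = B * \<bar>h \<bullet> a\<bar> + B * (\<Sum>b\<in>A. \<bar>h \<bullet> b\<bar>)"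
        using insert by (simp add: distrib_left)
      ultimately show ?case by (smt (verit))
    qed
    have "eventually (\<lambda>y. norm (f y - f x) \<le> B * (\<Sum>b\<in>Basis. \<bar>(y - x) \<bullet> b\<bar>)) (at x)"
      unfolding eventually_at
    proof (intro exI[of _ 1] conjI ballI impI)
      fix y assume "y \<noteq> x \<and> dist y x < 1"
      then show "norm (f y - f x) \<le> B * (\<Sum>b\<in>Basis. \<bar>(y - x) \<bullet> b\<bar>)"
        using step[of Basis "y - x"] by (simp add: euclidean_representation dist_norm)
    qed simp
    moreover have "((\<lambda>y. B * (\<Sum>b\<in>Basis. \<bar>(y - x) \<bullet> b\<bar>)) \<longlongrightarrow> B * (\<Sum>b\<in>Basis. \<bar>(x - x) \<bullet> b\<bar>)) (at x)"
      by (intro tendsto_intros)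
    ultimately have "((\<lambda>y. f y - f x) \<longlongrightarrow> 0) (at x)"
      by (auto intro: Lim_null_comparison)
    then show ?thesis
      unfolding isCont_def using LIM_zero_iff by blast
  qed
  then show ?thesis by (simp add: continuous_on_eq_continuous_at)
qed

lemma continuous_partial_deriv:
  fixes f :: "'a::euclidean_space \<Rightarrow> real"
  assumes "second_partials_Lipschitz f" and "b \<in> Basis"
  shows "continuous_on UNIV (partial_deriv b f)"
proof (rule continuous_if_continuous_partials)
  fix b' :: 'a assume b': "b' \<in> Basis"
  show "partial_differentiable b' (partial_deriv b f) x" for x
    using assms b' by (simp add: second_partials_Lipschitz_def)
  obtain K where "K-lipschitz_on UNIV (partial_deriv b' (partial_deriv b f))"
    using assms b' unfolding second_partials_Lipschitz_def by blast
  then show "continuous_on UNIV (partial_deriv b' (partial_deriv b f))"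
    by (rule lipschitz_on_continuous_on)
qed

section \<open>Gradient estimates from the quadratic bounds\<close>

text \<open>At the auxiliary point \<open>b - t *\<^sub>R u\<close>, where
  \<open>u = g b - g a\<close>, the lower bound based at \<open>a\<close> meets the upper bound
  based at \<open>b\<close>; this is \<open>half\<close>. Adding its two instances with
  \<open>x\<close> and \<open>y\<close> exchanged cancels the values of \<open>h\<close>.\<close>

lemma cocoercive_of_quadratic_bounds:
  fixes h :: "'a::real_inner \<Rightarrow> real" and g :: "'a \<Rightarrow> 'a"
  assumes lo: "\<And>x y. h x + g x \<bullet> (y - x) \<le> h y"
    and up: "\<And>x y. h y \<le> h x + g x \<bullet> (y - x) + M / 2 * (norm (y - x))\<^sup>2"
    and "0 \<le> M"
  shows "(norm (g x - g y))\<^sup>2 \<le> M * ((g x - g y) \<bullet> (x - y))"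
proof -
  define v where "v = g x - g y"
  have half: "h a + g a \<bullet> (b - a) + (t - M / 2 * t\<^sup>2) * (norm (g b - g a))\<^sup>2 \<le> h b" for a b t
  proof -
    define u where "u = g b - g a"
    have "h a + (g a \<bullet> (b - a) - t * (g a \<bullet> u)) \<le> h (b - t *\<^sub>R u)"
      using lo[of a "b - t *\<^sub>R u"] by (simp add: inner_diff_right)
    also have "\<dots> \<le> h b - t * (g b \<bullet> u) + M / 2 * (t\<^sup>2 * (norm u)\<^sup>2)"
      using up[of "b - t *\<^sub>R u" b] by (simp add: power_mult_distrib)
    moreover have "t * (g b \<bullet> u) - t * (g a \<bullet> u) = t * (norm u)\<^sup>2"
      unfolding power2_norm_eq_inner by (simp add: u_def inner_diff_left right_diff_distrib)
    ultimately show ?thesis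
      by (simp add: u_def[symmetric] left_diff_distrib)
  qed
  have sum: "(2 * t - M * t\<^sup>2) * (norm v)\<^sup>2 \<le> v \<bullet> (x - y)" for t
    using half[of x y t] half[of y x t]
    by (simp add: v_def norm_minus_commute[of "g y"] inner_diff_left inner_diff_right algebra_simps)
  show ?thesis
  \<comment> \<open>For positive \<open>M\<close> the factor \<open>2 * t - M * t\<^sup>2\<close> is
    largest at \<open>t = 1 / M\<close>. The case \<open>M = 0\<close> arises when
    \<open>m = L\<close>; there the bounds make \<open>h\<close> affine, and \<open>t = 1\<close>
    forces \<open>v = 0\<close>.\<close>
  proof (cases "M = 0")
    case True
    have "v \<bullet> (x - y) \<le> 0"
      using lo[of x y] up[of y x] lo[of y x] up[of x y] True
      by (simp add: v_def inner_diff_left inner_diff_right)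
    moreover have "2 * (norm v)\<^sup>2 \<le> v \<bullet> (x - y)"
      using sum[of 1] True by simp
    ultimately have "(norm v)\<^sup>2 \<le> 0" by linarith
    then show ?thesis by (simp add: True v_def)
  next
    case False
    then have "0 < M" using \<open>0 \<le> M\<close> by simp
    moreover have "2 * (1 / M) - M * (1 / M)\<^sup>2 = 1 / M"
      using False by (simp add: power2_eq_square)
    ultimately show ?thesis using sum[of "1 / M"] by (simp add: v_def field_simps)
  qed
qed

locale quadratic_bounds =
  fixes f :: "'a::real_inner \<Rightarrow> real" and g :: "'a \<Rightarrow> 'a" and m L :: real
  assumes lower: "f x + g x \<bullet> (y - x) + m / 2 * (norm (y - x))\<^sup>2 \<le> f y"
    and upper: "f y \<le> f x + g x \<bullet> (y - x) + L / 2 * (norm (y - x))\<^sup>2"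
    and m_pos: "0 < m"
    and m_le_L: "m \<le> L"
begin

lemma strongly_monotone: "m * (norm (x - y))\<^sup>2 \<le> (g x - g y) \<bullet> (x - y)"
  using lower[of x y] lower[of y x]
  by (simp add: norm_minus_commute[of y] inner_diff_left inner_diff_right)

lemma gradient_difference_in_ball:
  "norm (g x - g y - ((m + L) / 2) *\<^sub>R (x - y)) \<le> (L - m) / 2 * norm (x - y)"
proof -
  define h where "h = (\<lambda>z. f z - m / 2 * (norm z)\<^sup>2)"
  define v where "v = g x - g y - m *\<^sub>R (x - y)"
  define d where "d = x - y"
  have "(norm ((g x - m *\<^sub>R x) - (g y - m *\<^sub>R y)))\<^sup>2
      \<le> (L - m) * (((g x - m *\<^sub>R x) - (g y - m *\<^sub>R y)) \<bullet> (x - y))"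
  proof (rule cocoercive_of_quadratic_bounds[of h])
    fix x y
    \<comment> \<open>Expanding the square shows how tilting by the quadratic alters the linear
      term; the curvature constants \<open>m\<close> and \<open>L\<close> of \<open>f\<close> become
      \<open>0\<close> and \<open>L - m\<close> for \<open>h\<close>.\<close>
    have "(g x - m *\<^sub>R x) \<bullet> (y - x) = g x \<bullet> (y - x) + m / 2 * (norm (y - x))\<^sup>2
        - m / 2 * (norm y)\<^sup>2 + m / 2 * (norm x)\<^sup>2"
      unfolding power2_norm_eq_inner
      by (simp add: inner_diff_left inner_diff_right inner_commute algebra_simps)
    then show "h x + (g x - m *\<^sub>R x) \<bullet> (y - x) \<le> h y"
      and "h y \<le> h x + (g x - m *\<^sub>R x) \<bullet> (y - x) + (L - m) / 2 * (norm (y - x))\<^sup>2"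
      using lower[of x y] upper[of y x] by (auto simp: h_def algebra_simps diff_divide_distrib)
  qed (use m_le_L in simp)
  moreover have "(g x - m *\<^sub>R x) - (g y - m *\<^sub>R y) = v"
    by (simp add: v_def algebra_simps)
  ultimately have "v \<bullet> v \<le> (L - m) * (v \<bullet> d)"
    by (simp add: power2_norm_eq_inner d_def)
  \<comment> \<open>For \<open>r = (L - m) / 2\<close> the preceding inequality makes the first two
    terms at most \<open>0\<close>: \<open>v\<close> lies in the ball with diameter from
    \<open>0\<close> to \<open>(L - m) *\<^sub>R d\<close>. Adding \<open>m *\<^sub>R d\<close> back
    then shifts the centre to \<open>((m + L) / 2) *\<^sub>R d\<close>.\<close>
  moreover have "(norm (v - r *\<^sub>R d))\<^sup>2 = v \<bullet> v - 2 * r * (v \<bullet> d) + (r * norm d)\<^sup>2" for r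
    unfolding power_mult_distrib power2_norm_eq_inner
    by (simp add: inner_diff_left inner_diff_right inner_commute power2_eq_square algebra_simps)
  moreover have "2 * ((L - m) / 2) = L - m" by simp
  ultimately have "(norm (v - ((L - m) / 2) *\<^sub>R d))\<^sup>2 \<le> ((L - m) / 2 * norm d)\<^sup>2"
    by (simp only:)
  then have "norm (v - ((L - m) / 2) *\<^sub>R d) \<le> (L - m) / 2 * norm d"
    by (rule power2_le_imp_le) (use m_le_L in simp)
  moreover have "m *\<^sub>R d + ((L - m) / 2) *\<^sub>R d = ((m + L) / 2) *\<^sub>R d"
    by (simp add: scaleR_left_distrib[symmetric] field_simps)
  then have "v - ((L - m) / 2) *\<^sub>R d = g x - g y - ((m + L) / 2) *\<^sub>R d"
    unfolding v_def d_def[symmetric] by (simp add: diff_diff_eq)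
  ultimately show ?thesis by (simp add: d_def)
qed

text \<open>The centre of the ball contributes a pure scaling of \<open>x - y\<close>, the deviation
  \<open>w\<close> from it at most \<open>\<alpha>\<close> times the radius.\<close>

lemma gradient_step_lipschitz:
  assumes "0 \<le> \<alpha>"
  shows "norm ((x - \<alpha> *\<^sub>R g x) - (y - \<alpha> *\<^sub>R g y)) \<le> max \<bar>1 - \<alpha> * m\<bar> \<bar>1 - \<alpha> * L\<bar> * norm (x - y)"
proof -
  define w where "w = g x - g y - ((m + L) / 2) *\<^sub>R (x - y)"
  have "(x - \<alpha> *\<^sub>R g x) - (y - \<alpha> *\<^sub>R g y) = (1 - \<alpha> * ((m + L) / 2)) *\<^sub>R (x - y) - \<alpha> *\<^sub>R w"
    by (simp add: w_def scaleR_diff_right scaleR_diff_left)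
  then have "norm ((x - \<alpha> *\<^sub>R g x) - (y - \<alpha> *\<^sub>R g y))
      \<le> \<bar>1 - \<alpha> * ((m + L) / 2)\<bar> * norm (x - y) + \<alpha> * norm w"
    using norm_triangle_ineq4[of "(1 - \<alpha> * ((m + L) / 2)) *\<^sub>R (x - y)" "\<alpha> *\<^sub>R w"] assms by simp
  also have "\<dots> \<le> \<bar>1 - \<alpha> * ((m + L) / 2)\<bar> * norm (x - y) + \<alpha> * ((L - m) / 2 * norm (x - y))"
    using gradient_difference_in_ball assms by (intro add_left_mono mult_left_mono) (auto simp: w_def)
  also have "\<dots> = (\<bar>1 - \<alpha> * ((m + L) / 2)\<bar> + \<alpha> * ((L - m) / 2)) * norm (x - y)"
    by (simp add: algebra_simps)
  \<comment> \<open>This is \<open>max \<bar>p\<bar> \<bar>q\<bar> = \<bar>p + q\<bar> / 2 + \<bar>p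
    - q\<bar> / 2\<close> for \<open>p = 1 - \<alpha> * m\<close> and
    \<open>q = 1 - \<alpha> * L\<close>.\<close>
  also have "\<bar>1 - \<alpha> * ((m + L) / 2)\<bar> + \<alpha> * ((L - m) / 2) = max \<bar>1 - \<alpha> * m\<bar> \<bar>1 - \<alpha> * L\<bar>"
    using mult_left_mono[OF m_le_L assms] by (simp add: abs_if max_def field_simps)
  finally show ?thesis .
qed

text \<open>The two bounds squeeze the difference quotient with an error linear in \<open>t\<close>.
  This links the components of \<open>grad\<close> to \<open>partial_deriv\<close>, whose continuity
  is known.\<close>

lemma has_directional_derivative:
  "((\<lambda>t. f (x + t *\<^sub>R b)) has_field_derivative g x \<bullet> b) (at 0)"
proof -
  have "norm ((f (x + t *\<^sub>R b) - f x) / t - g x \<bullet> b) \<le> L / 2 * (norm b)\<^sup>2 * \<bar>t\<bar>" if "t \<noteq> 0" for t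
  proof -
    have "0 \<le> m / 2 * (norm (t *\<^sub>R b))\<^sup>2" using m_pos by simp
    then have "\<bar>f (x + t *\<^sub>R b) - f x - t * (g x \<bullet> b)\<bar> \<le> L / 2 * (norm (t *\<^sub>R b))\<^sup>2"
      using lower[of x "x + t *\<^sub>R b"] upper[of "x + t *\<^sub>R b" x] by auto
    moreover have "(f (x + t *\<^sub>R b) - f x) / t - g x \<bullet> b = (f (x + t *\<^sub>R b) - f x - t * (g x \<bullet> b)) / t"
      using that by (simp add: field_simps)
    ultimately show ?thesis
      using that by (simp add: abs_divide field_simps power_mult_distrib power2_eq_square)
  qed
  then have "eventually (\<lambda>t. norm ((f (x + t *\<^sub>R b) - f x) / t - g x \<bullet> b)
      \<le> L / 2 * (norm b)\<^sup>2 * \<bar>t\<bar>) (at 0)"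
    by (auto simp: eventually_at_filter)
  moreover have "((\<lambda>t::real. L / 2 * (norm b)\<^sup>2 * \<bar>t\<bar>) \<longlongrightarrow> 0) (at 0)"
    by (auto intro!: tendsto_eq_intros)
  ultimately have "((\<lambda>t. (f (x + t *\<^sub>R b) - f x) / t - g x \<bullet> b) \<longlongrightarrow> 0) (at 0)"
    by (rule Lim_null_comparison)
  then show ?thesis
    unfolding DERIV_def using LIM_zero_iff by force
qed

text \<open>The lower bound based at \<open>z\<close> loses its linear term to the variational
  inequality; the remaining quadratic growth gives minimality and uniqueness together, as the
  description operator demands.\<close>

lemma minimizer_if_variational_inequality:
  assumes "z \<in> S" and "\<And>y. y \<in> S \<Longrightarrow> 0 \<le> g z \<bullet> (y - z)"
  shows "(THE x. is_arg_min f (\<lambda>x. x \<in> S) x) = z"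
proof (rule the_equality)
  have above: "f z + m / 2 * (norm (y - z))\<^sup>2 \<le> f y" if "y \<in> S" for y
    using lower[of z y] assms(2)[OF that] by simp
  moreover have "0 \<le> m / 2 * (norm (y - z))\<^sup>2" for y using m_pos by simp
  ultimately have "f z \<le> f y" if "y \<in> S" for y using that by (smt (verit))
  then show "is_arg_min f (\<lambda>x. x \<in> S) z"
    using assms(1) by (auto simp: is_arg_min_linorder)
  fix x assume "is_arg_min f (\<lambda>x. x \<in> S) x"
  then have "x \<in> S" "f x \<le> f z" using assms(1) by (auto simp: is_arg_min_linorder)
  then have "m / 2 * (norm (x - z))\<^sup>2 \<le> 0" using above[of x] by simp
  then show "x = z" using m_pos by (simp add: mult_le_0_iff)
qed

end

section \<open>Projection, attained maxima and Hausdorff distance\<close>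

text \<open>Projections are characterized by an obtuse angle at the projected point; in that
  inequality \<open>\<alpha>\<close> is only a positive factor and drops out.\<close>

lemma closest_point_step_eq_iff:
  fixes z v :: "'a::euclidean_space"
  assumes S: "convex S" "closed S" and "z \<in> S" and "0 < \<alpha>"
  shows "closest_point S (z - \<alpha> *\<^sub>R v) = z \<longleftrightarrow> (\<forall>y\<in>S. 0 \<le> v \<bullet> (y - z))"
proof
  assume eq: "closest_point S (z - \<alpha> *\<^sub>R v) = z"
  show "\<forall>y\<in>S. 0 \<le> v \<bullet> (y - z)"
  proof
    fix y assume "y \<in> S"
    from closest_point_dot[OF S this, of "z - \<alpha> *\<^sub>R v"] show "0 \<le> v \<bullet> (y - z)"
      using \<open>0 < \<alpha>\<close> unfolding eq by (simp add: zero_le_mult_iff)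
  qed
next
  assume vi: "\<forall>y\<in>S. 0 \<le> v \<bullet> (y - z)"
  define p where "p = closest_point S (z - \<alpha> *\<^sub>R v)"
  have "p \<in> S"
    unfolding p_def using S \<open>z \<in> S\<close> by (intro closest_point_in_set) auto
  \<comment> \<open>The variational inequality tested at \<open>p\<close> and the obtuse angle
    inequality tested at \<open>z\<close> add up to \<open>p = z\<close>.\<close>
  then have "0 \<le> \<alpha> * (v \<bullet> (p - z))" using vi \<open>0 < \<alpha>\<close> by simp
  moreover have "(z - \<alpha> *\<^sub>R v - p) \<bullet> (z - p) \<le> 0"
    unfolding p_def by (rule closest_point_dot[OF S \<open>z \<in> S\<close>])
  ultimately have "(z - p) \<bullet> (z - p) \<le> 0"
    by (simp add: inner_diff_left inner_diff_right algebra_simps)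
  then have "(z - p) \<bullet> (z - p) = 0" by (intro antisym) auto
  then show "closest_point S (z - \<alpha> *\<^sub>R v) = z" by (simp add: p_def)
qed

text \<open>\<open>GREATEST\<close> is an upper bound only once a greatest element is known to
  exist; compactness supplies it.\<close>

lemma Greatest_ge_of_compact:
  fixes A :: "real set"
  assumes "compact A" and "x \<in> A"
  shows "x \<le> (GREATEST r. r \<in> A)"
proof -
  obtain s where "s \<in> A" "\<forall>t\<in>A. t \<le> s"
    using compact_attains_sup[OF assms(1)] assms(2) by blast
  then have "(GREATEST r. r \<in> A) = s" by (intro Greatest_equality) auto
  then show ?thesis using \<open>\<forall>t\<in>A. t \<le> s\<close> assms(2) by simp
qed

lemma contraction_rate_ge:
  assumes "\<alpha> \<in> {c..C}"
  shows "max \<bar>1 - \<alpha> * m\<bar> \<bar>1 - \<alpha> * L\<bar> \<le> contraction_rate m L c C"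
  unfolding contraction_rate_def
proof (rule Greatest_ge_of_compact)
  show "compact ((\<lambda>\<alpha>. max \<bar>1 - \<alpha> * m\<bar> \<bar>1 - \<alpha> * L\<bar>) ` {c..C})"
    by (intro compact_continuous_image continuous_intros) auto
qed (use assms in blast)

text \<open>Points of the two images with the same parameter serve as each other's
  approximants.\<close>

lemma Hausdorff_dist_image_le:
  assumes "\<And>x. x \<in> A \<Longrightarrow> norm (u x - v x) \<le> B" and "0 \<le> B"
  shows "Hausdorff_dist (u ` A) (v ` A) \<le> ereal B"
proof (rule ereal_le_epsilon2)
  fix e :: real assume "0 < e"
  \<comment> \<open>The infimum ranges over positive radii while \<open>B\<close> may be
    \<open>0\<close>, hence the slack \<open>e\<close>.\<close>
  define r where "r = B + e"
  have r: "0 < r" using \<open>0 < e\<close> \<open>0 \<le> B\<close> by (simp add: r_def)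
  have sub: "p ` A \<subseteq> q ` A + (*\<^sub>R) r ` cball 0 1"
    if pq: "\<And>x. x \<in> A \<Longrightarrow> norm (p x - q x) \<le> B" for p q :: "'a \<Rightarrow> 'b"
  proof
    fix z assume "z \<in> p ` A"
    then obtain x where x: "x \<in> A" "z = p x" by blast
    have "norm (p x - q x) \<le> r" using pq[OF x(1)] \<open>0 < e\<close> by (simp add: r_def)
    then have "norm ((1 / r) *\<^sub>R (p x - q x)) \<le> 1" using r by (simp del: scaleR_diff_right)
    moreover have "z = q x + r *\<^sub>R ((1 / r) *\<^sub>R (p x - q x))"
      using x r by simp
    ultimately show "z \<in> q ` A + (*\<^sub>R) r ` cball 0 1"
      using x(1) by (auto intro!: set_plus_intro imageI simp del: scaleR_scaleR scaleR_diff_right)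
  qed
  have "Hausdorff_dist (u ` A) (v ` A) \<le> ereal r"
    unfolding Hausdorff_dist_def
    using r sub[of u v] sub[of v u] assms(1) by (intro INF_lower) (auto simp: norm_minus_commute)
  then show "Hausdorff_dist (u ` A) (v ` A) \<le> ereal B + ereal e"
    by (simp add: r_def)
qed

section \<open>Convergence of the iterates and continuity of the minimizer\<close>

theorem theorem1:
  fixes J :: "(real ^ 'n) \<times> (real ^ 'd) \<Rightarrow> real"
    and S_C S0 :: "(real ^ 'n) set"
    and \<Theta> :: "(real ^ 'd) set"
    and m L c C :: real
  assumes "second_partials_Lipschitz J"
    and "0 < m" and "m \<le> L"
    and "\<And>\<theta> \<xi> \<xi>'. \<theta> \<in> \<Theta> \<Longrightarrow>
           J (\<xi>, \<theta>) + grad (\<lambda>\<xi>. J (\<xi>, \<theta>)) \<xi> \<bullet> (\<xi>' - \<xi>) + m / 2 * (norm (\<xi>' - \<xi>))\<^sup>2 \<le> J (\<xi>', \<theta>)"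
    and "\<And>\<theta> \<xi> \<xi>'. \<theta> \<in> \<Theta> \<Longrightarrow>
           J (\<xi>', \<theta>) \<le> J (\<xi>, \<theta>) + grad (\<lambda>\<xi>. J (\<xi>, \<theta>)) \<xi> \<bullet> (\<xi>' - \<xi>) + L / 2 * (norm (\<xi>' - \<xi>))\<^sup>2"
    and "convex S_C" and "closed S_C"
    and "convex \<Theta>" and "compact \<Theta>" and "\<Theta> \<noteq> {}"
    and "S0 \<subseteq> S_C" and "bounded S0"
    and "c \<in> {0<..<2 / L}" and "C \<in> {0<..<2 / L}" and "c \<le> C"
  shows "\<forall>\<xi>0\<in>S0. \<forall>k. \<forall>\<alpha>. (\<forall>j<k. \<alpha> j \<in> {c..C}) \<longrightarrow>
           Hausdorff_dist (minimizer_set J S_C \<Theta>) (reachable_set J S_C \<Theta> k \<xi>0 \<alpha>)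
             \<le> ereal (error_bound J S_C \<Theta> (contraction_rate m L c C) k \<xi>0)"
proof (intro ballI allI impI)
  fix \<xi>0 and k :: nat and \<alpha> :: "nat \<Rightarrow> real"
  assume \<xi>0: "\<xi>0 \<in> S0" and \<alpha>: "\<forall>j<k. \<alpha> j \<in> {c..C}"
  define g where "g \<theta> = grad (\<lambda>\<xi>. J (\<xi>, \<theta>))" for \<theta>
  define z where "z = minimizer J S_C"
  define \<gamma> where "\<gamma> = contraction_rate m L c C"
  have ne: "S_C \<noteq> {}" using \<xi>0 assms(11) by auto
  have L: "0 < L" using assms(2,3) by simp
  have c: "0 < c" "c * L < 2" using assms(13) L by (auto simp: field_simps)
  have qb: "quadratic_bounds (\<lambda>\<xi>. J (\<xi>, \<theta>)) (g \<theta>) m L" if "\<theta> \<in> \<Theta>" for \<theta>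
    using assms(2-5) that by (auto simp: quadratic_bounds_def g_def)
  have step: "norm (f_PGD J S_C x \<theta> a - f_PGD J S_C y \<theta> a)
      \<le> max \<bar>1 - a * m\<bar> \<bar>1 - a * L\<bar> * norm (x - y)" if "\<theta> \<in> \<Theta>" "0 \<le> a" for \<theta> a x y
    using closest_point_lipschitz[OF assms(6,7) ne, of "x - a *\<^sub>R g \<theta> x" "y - a *\<^sub>R g \<theta> y"]
      quadratic_bounds.gradient_step_lipschitz[OF qb[OF that(1)] that(2), of x y]
    by (simp add: f_PGD_def g_def dist_norm)
  have z: "z \<theta> \<in> S_C \<and> (\<forall>y\<in>S_C. 0 \<le> g \<theta> (z \<theta>) \<bullet> (y - z \<theta>))" if \<theta>: "\<theta> \<in> \<Theta>" for \<theta>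
  proof -
    have "c * m \<le> c * L" "0 < c * m" using c(1) assms(2,3) by (auto intro: mult_left_mono)
    then have "max \<bar>1 - c * m\<bar> \<bar>1 - c * L\<bar> < 1"
      using c(2) by (auto simp: abs_if)
    \<comment> \<open>Existence of a minimizer comes from Banach's theorem for the PGD map with the
      single step size \<open>c\<close> on the closed set \<open>S_C\<close>.\<close>
    then have "\<exists>!x\<in>S_C. f_PGD J S_C x \<theta> c = x"
      using step[OF \<theta>, of c] c(1) ne assms(7)
      by (intro Banach_fix[where c = "max \<bar>1 - c * m\<bar> \<bar>1 - c * L\<bar>"])
        (auto simp: complete_eq_closed dist_norm f_PGD_def closest_point_in_set[OF assms(7) ne])
    then obtain x where x: "x \<in> S_C" "closest_point S_C (x - c *\<^sub>R g \<theta> x) = x"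
      by (auto simp: f_PGD_def g_def)
    then have vi: "\<forall>y\<in>S_C. 0 \<le> g \<theta> x \<bullet> (y - x)"
      using closest_point_step_eq_iff[OF assms(6,7) x(1) c(1)] by blast
    then have "z \<theta> = x"
      using quadratic_bounds.minimizer_if_variational_inequality[OF qb[OF \<theta>] x(1)]
      by (simp add: z_def minimizer_def)
    then show ?thesis using x(1) vi by simp
  qed
  \<comment> \<open>The induction is confined to \<open>i \<le> k\<close> because only the
    \<open>\<alpha> j\<close> with \<open>j < k\<close> are known to lie in
    \<open>{c..C}\<close>.\<close>
  have iter: "norm (pgd_iterate J S_C i \<xi>0 \<theta> \<alpha> - z \<theta>) \<le> \<gamma> ^ i * norm (z \<theta> - \<xi>0)"
    if \<theta>: "\<theta> \<in> \<Theta>" and "i \<le> k" for \<theta> i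
    using that(2)
  proof (induction i)
    case 0
    then show ?case by (simp add: norm_minus_commute)
  next
    case (Suc i)
    have a: "\<alpha> i \<in> {c..C}" using \<alpha> Suc.prems by simp
    then have pos: "0 < \<alpha> i" using c(1) by auto
    have fix_z: "f_PGD J S_C (z \<theta>) \<theta> (\<alpha> i) = z \<theta>"
      using closest_point_step_eq_iff[OF assms(6,7) _ pos] z[OF \<theta>] by (simp add: f_PGD_def g_def)
    have rate: "max \<bar>1 - \<alpha> i * m\<bar> \<bar>1 - \<alpha> i * L\<bar> \<le> \<gamma>"
      unfolding \<gamma>_def by (rule contraction_rate_ge[OF a])
    have "norm (pgd_iterate J S_C (Suc i) \<xi>0 \<theta> \<alpha> - z \<theta>)
        \<le> max \<bar>1 - \<alpha> i * m\<bar> \<bar>1 - \<alpha> i * L\<bar> * norm (pgd_iterate J S_C i \<xi>0 \<theta> \<alpha> - z \<theta>)"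
      using step[OF \<theta>, of "\<alpha> i" "pgd_iterate J S_C i \<xi>0 \<theta> \<alpha>" "z \<theta>"] pos by (simp add: fix_z)
    also have "\<dots> \<le> \<gamma> * (\<gamma> ^ i * norm (z \<theta> - \<xi>0))"
      using rate Suc by (intro mult_mono) auto
    finally show ?case by (simp add: mult.assoc)
  qed
  \<comment> \<open>The component of the gradient along \<open>b\<close> is the partial derivative
    of \<open>J\<close> along \<open>(b, 0)\<close>, restricted to the slice with first argument
    \<open>\<xi>\<close>.\<close>
  have cont_g: "continuous_on \<Theta> (\<lambda>\<theta>. g \<theta> \<xi>)" for \<xi>
  proof (rule continuous_on_componentwise[THEN iffD2], rule ballI)
    fix b :: "real ^ 'n" assume "b \<in> Basis"
    then have "(b, 0) \<in> (Basis :: ((real ^ 'n) \<times> (real ^ 'd)) set)" by (simp add: Basis_prod_def)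
    then have "continuous_on UNIV (partial_deriv (b, 0) J)"
      by (rule continuous_partial_deriv[OF assms(1)])
    then have "continuous_on \<Theta> (\<lambda>\<theta>. partial_deriv (b, 0) J (\<xi>, \<theta>))"
      by (rule continuous_on_compose2) (auto intro!: continuous_intros)
    moreover have "partial_deriv (b, 0) J (\<xi>, \<theta>) = g \<theta> \<xi> \<bullet> b" if "\<theta> \<in> \<Theta>" for \<theta>
      using quadratic_bounds.has_directional_derivative[OF qb[OF that], of \<xi> b]
      by (simp add: partial_deriv_def DERIV_imp_deriv)
    ultimately show "continuous_on \<Theta> (\<lambda>\<theta>. g \<theta> \<xi> \<bullet> b)" by simp
  qed
  \<comment> \<open>Each variational inequality is tested at the other minimizer and combined with
    strong monotonicity for \<open>\<theta>'\<close>. Both gradients on the right are taken at the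
    fixed point \<open>z \<theta>\<close>, so \<open>cont_g\<close> applies as
    \<open>\<theta>'\<close> varies.\<close>
  have z_lipschitz: "norm (z \<theta>' - z \<theta>) \<le> norm (g \<theta>' (z \<theta>) - g \<theta> (z \<theta>)) / m"
    if "\<theta> \<in> \<Theta>" "\<theta>' \<in> \<Theta>" for \<theta> \<theta>'
  proof -
    define d where "d = z \<theta>' - z \<theta>"
    have "0 \<le> g \<theta>' (z \<theta>') \<bullet> (z \<theta> - z \<theta>')" "0 \<le> g \<theta> (z \<theta>) \<bullet> (z \<theta>' - z \<theta>)"
      using z that by auto
    with quadratic_bounds.strongly_monotone[OF qb[OF that(2)], of "z \<theta>'" "z \<theta>"]
    have "m * (norm d)\<^sup>2 \<le> (g \<theta> (z \<theta>) - g \<theta>' (z \<theta>)) \<bullet> d"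
      by (simp add: d_def inner_diff_left inner_diff_right)
    also have "\<dots> \<le> norm (g \<theta>' (z \<theta>) - g \<theta> (z \<theta>)) * norm d"
      using norm_cauchy_schwarz norm_minus_commute by metis
    finally have "m * norm d \<le> norm (g \<theta>' (z \<theta>) - g \<theta> (z \<theta>))"
      by (cases "d = 0") (auto simp: power2_eq_square)
    then show ?thesis using assms(2) by (simp add: d_def field_simps)
  qed
  have "continuous_on \<Theta> z"
    unfolding continuous_on_def
  proof
    fix \<theta> assume \<theta>: "\<theta> \<in> \<Theta>"
    have "((\<lambda>\<theta>'. norm (g \<theta>' (z \<theta>) - g \<theta> (z \<theta>)) / m) \<longlongrightarrow> norm (g \<theta> (z \<theta>) - g \<theta> (z \<theta>)) / m)
        (at \<theta> within \<Theta>)"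
      using cont_g[of "z \<theta>", unfolded continuous_on_def, rule_format, OF \<theta>] assms(2)
      by (intro tendsto_intros) auto
    then have lim: "((\<lambda>\<theta>'. norm (g \<theta>' (z \<theta>) - g \<theta> (z \<theta>)) / m) \<longlongrightarrow> 0) (at \<theta> within \<Theta>)"
      by simp
    have "((\<lambda>\<theta>'. z \<theta>' - z \<theta>) \<longlongrightarrow> 0) (at \<theta> within \<Theta>)"
      by (rule Lim_null_comparison[OF _ lim]) (use z_lipschitz \<theta> in \<open>auto simp: eventually_at_filter\<close>)
    then show "(z \<longlongrightarrow> z \<theta>) (at \<theta> within \<Theta>)" by (rule LIM_zero_cancel)
  qed
  then have "compact ((\<lambda>\<theta>. norm (z \<theta> - \<xi>0)) ` \<Theta>)"
    by (intro compact_continuous_image assms continuous_intros)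
  then have max: "norm (z \<theta> - \<xi>0) \<le> (GREATEST r. r \<in> (\<lambda>\<theta>. norm (z \<theta> - \<xi>0)) ` \<Theta>)"
    if "\<theta> \<in> \<Theta>" for \<theta>
    using that by (intro Greatest_ge_of_compact) auto
  have "0 \<le> \<gamma>"
    using contraction_rate_ge[of c c C m L] assms(15) by (auto simp: \<gamma>_def intro: order_trans[OF abs_ge_zero])
  then have close: "norm (z \<theta> - pgd_iterate J S_C k \<xi>0 \<theta> \<alpha>) \<le> error_bound J S_C \<Theta> \<gamma> k \<xi>0"
    if "\<theta> \<in> \<Theta>" for \<theta>
    using iter[OF that order_refl] mult_left_mono[OF max[OF that], of "\<gamma> ^ k"]
    by (simp add: norm_minus_commute error_bound_def z_def)
  moreover have "0 \<le> error_bound J S_C \<Theta> \<gamma> k \<xi>0"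
    using close assms(10) norm_ge_zero order_trans by blast
  ultimately show "Hausdorff_dist (minimizer_set J S_C \<Theta>) (reachable_set J S_C \<Theta> k \<xi>0 \<alpha>)
      \<le> ereal (error_bound J S_C \<Theta> (contraction_rate m L c C) k \<xi>0)"
    unfolding minimizer_set_def reachable_set_def \<gamma>_def[symmetric] z_def[symmetric]
    by (intro Hausdorff_dist_image_le) auto
qed

end
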